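(* Let $n\ge2$ and let $\mathcal{A}=(A;E_i)_{i\in n}$ be an $n$-grid which is not twisted. Then for every $l\in\omega$, the finite $n$-cube $l^n$ can be embedded in $\mathcal{A}$.
   Context: For $n\ge2$, an $n$-grid is a structure $\mathcal{A}=(A;E_i)_{i\in n}$ where each $E_i$ is an equivalence relation on $A$ and $[a]_i\cap[a]_j$ is finite whenever $a\in A$, $i<j<n$ ($[a]_i$ is the $E_i$-class of $a$). An $n$-cube is the $n$-grid on $A_0\times\cdots\times A_{n-1}$ where two $n$-tuples are $E_i$-related iff they agree in all coordinates except possibly the $i$-th; $l^n$ denotes this cube with $A_0=\cdots=A_{n-1}=l=\{0,\dots,l-1\}$. An embedding of an $n$-grid $(B;F_i)_{i\in n}$ into $\mathcal{A}$ is an injective map $f:B\to A$ such that for all $x,y\in B$ and $i\in n$, $x\,F_i\,y$ iff $f(x)\,E_i\,f(y)$. For an equivalence relation $E$ on $A$, $B\subseteq A$ is $E$-small if every $E$-class meets $B$ in a finite set. An "elementary submodel of the universe" is an $M$ with $(M,\in)\prec(H(\theta),\in)$ for a fixed sufficiently large regular cardinal $\theta$. A test set for $\mathcal{A}$ is a set $\mathcal{M}$ of elementary submodels with $\mathcal{A}\in M$ for all $M\in\mathcal{M}$, $|\mathcal{M}|=n-1$, and $\mathcal{M}$ linearly ordered by $\in$. $\mathcal{A}$ is twisted if for every test set $\mathcal{M}$ and every $k\in n$, the set $\{x\in A\setminus\bigcup\mathcal{M} : [x]_i\in\bigcup\mathcal{M}\text{ for all } i\in n\setminus\{k\}\}$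 is $E_k$-small. *)

theory Defs
  imports Main "HOL-Library.FuncSet"
begin

unbundle cardinal_syntax

section \<open>Sets as elements of a type\<close>

text \<open>
  HOL has no type of all ZF sets, so the set-theoretic universe is an arbitrary type with a
  well-founded extensional membership relation; \<open>elts x\<close> is the extension of \<open>x\<close>. No closure
  axiom is part of the class: closure is imposed by \<open>contains_all_hereditary\<close> below, up to a
  cardinal \<open>\<theta>\<close>. Every model of ZFC with full second-order separation and replacement is an
  instance, and for regular \<open>\<theta>\<close> so is \<open>(H(\<theta>), \<in>)\<close> itself.
\<close>

class set_universe =
  fixes elts :: "'a \<Rightarrow> 'a set"
  assumes elts_inject: "elts x = elts y \<Longrightarrow> x = y"
    and wf_elts: "wf {(x, y). x \<in> elts y}"

definition trcl :: "'v::set_universe \<Rightarrow> 'v set" where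
  "trcl x = {y. (y, x) \<in> {(u, v). u \<in> elts v}\<^sup>+}"

text \<open>\<open>H(\<theta>)\<close>, the sets of hereditary cardinality less than \<open>\<theta>\<close>.\<close>

definition hereditary :: "'c rel \<Rightarrow> 'v::set_universe set" where
  "hereditary \<theta> = {x. |trcl x| <o \<theta>}"

text \<open>
  The universe omits no set of hereditary cardinality less than \<open>\<theta>\<close>, so that \<open>hereditary \<theta>\<close>
  really is \<open>H(\<theta>)\<close>.
\<close>

definition contains_all_hereditary :: "'v::set_universe itself \<Rightarrow> 'c rel \<Rightarrow> bool" where
  "contains_all_hereditary _ \<theta> \<longleftrightarrow>
     (\<forall>X :: 'v set. X \<subseteq> hereditary \<theta> \<and> |X| <o \<theta> \<longrightarrow> X \<in> range elts)"

definition regular_uncountable :: "'c rel \<Rightarrow> bool" where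
  "regular_uncountable \<theta> \<longleftrightarrow> Card_order \<theta> \<and> natLeq <o \<theta> \<and> regularCard \<theta>"

text \<open>
  A collection \<open>X\<close> of sets, as a HOL set, belongs to \<open>M\<close> when it is the extension of an
  element of \<open>M\<close>.
\<close>

definition mem_as_set :: "'v::set_universe set \<Rightarrow> 'v set \<Rightarrow> bool" where
  "mem_as_set X M \<longleftrightarrow> (\<exists>v\<in>M. elts v = X)"


section \<open>Structures as sets\<close>

text \<open>The value of \<open>vset X\<close> is meaningful only for \<open>X\<close> in the range of \<open>elts\<close>.\<close>

definition vset :: "'v::set_universe set \<Rightarrow> 'v" where
  "vset X = (THE v. elts v = X)"

definition vpair :: "'v::set_universe \<Rightarrow> 'v \<Rightarrow> 'v" where
  "vpair x y = vset {vset {x}, vset {x, y}}"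

fun vnat :: "nat \<Rightarrow> 'v::set_universe" where
  "vnat 0 = vset {}"
| "vnat (Suc k) = vset (insert (vnat k) (elts (vnat k)))"

definition vrel :: "'v::set_universe rel \<Rightarrow> 'v" where
  "vrel R = vset {vpair x y | x y. (x, y) \<in> R}"

text \<open>The structure \<open>(A; E\<^sub>i)\<^bsub>i \<in> n\<^esub>\<close> as the pair of \<open>A\<close> and the function \<open>i \<mapsto> E\<^sub>i\<close> on \<open>n\<close>.\<close>

definition vstruct :: "nat \<Rightarrow> 'v::set_universe set \<Rightarrow> (nat \<Rightarrow> 'v rel) \<Rightarrow> 'v" where
  "vstruct n A E = vpair (vset A) (vset {vpair (vnat i) (vrel (E i)) | i. i < n})"


section \<open>Elementary submodels\<close>

text \<open>First-order formulas of set theory, with variables named by natural numbers.\<close>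

datatype fm = Mem nat nat | Eq nat nat | Neg fm | Conj fm fm | Forall nat fm

fun sat :: "'v::set_universe set \<Rightarrow> (nat \<Rightarrow> 'v) \<Rightarrow> fm \<Rightarrow> bool" where
  "sat M s (Mem i j) \<longleftrightarrow> s i \<in> elts (s j)"
| "sat M s (Eq i j) \<longleftrightarrow> s i = s j"
| "sat M s (Neg \<phi>) \<longleftrightarrow> \<not> sat M s \<phi>"
| "sat M s (Conj \<phi> \<psi>) \<longleftrightarrow> sat M s \<phi> \<and> sat M s \<psi>"
| "sat M s (Forall i \<phi>) \<longleftrightarrow> (\<forall>x\<in>M. sat M (s(i := x)) \<phi>)"

definition elementary_submodel :: "'v::set_universe set \<Rightarrow> 'v set \<Rightarrow> bool" where
  "elementary_submodel M N \<longleftrightarrow> M \<noteq> {} \<and> M \<subseteq> N \<and>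
     (\<forall>\<phi> s. (\<forall>i. s i \<in> M) \<longrightarrow> (sat M s \<phi> \<longleftrightarrow> sat N s \<phi>))"


section \<open>Grids\<close>

definition grid :: "nat \<Rightarrow> 'a set \<Rightarrow> (nat \<Rightarrow> 'a rel) \<Rightarrow> bool" where
  "grid n A E \<longleftrightarrow> (\<forall>i<n. equiv A (E i)) \<and>
     (\<forall>a\<in>A. \<forall>j<n. \<forall>i<j. finite (E i `` {a} \<inter> E j `` {a}))"

definition cube_carrier :: "nat \<Rightarrow> (nat \<Rightarrow> 'a set) \<Rightarrow> (nat \<Rightarrow> 'a) set" where
  "cube_carrier n A = (\<Pi>\<^sub>E i\<in>{..<n}. A i)"

definition cube_rel :: "nat \<Rightarrow> (nat \<Rightarrow> 'a set) \<Rightarrow> nat \<Rightarrow> (nat \<Rightarrow> 'a) rel" where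
  "cube_rel n A i = {(x, y). x \<in> cube_carrier n A \<and> y \<in> cube_carrier n A \<and>
     (\<forall>j<n. j \<noteq> i \<longrightarrow> x j = y j)}"

definition grid_embedding ::
  "nat \<Rightarrow> 'b set \<Rightarrow> (nat \<Rightarrow> 'b rel) \<Rightarrow> 'a set \<Rightarrow> (nat \<Rightarrow> 'a rel) \<Rightarrow> ('b \<Rightarrow> 'a) \<Rightarrow> bool" where
  "grid_embedding n B F A E f \<longleftrightarrow> f \<in> B \<rightarrow> A \<and> inj_on f B \<and>
     (\<forall>x\<in>B. \<forall>y\<in>B. \<forall>i<n. (x, y) \<in> F i \<longleftrightarrow> (f x, f y) \<in> E i)"

definition small :: "'a set \<Rightarrow> 'a rel \<Rightarrow> 'a set \<Rightarrow> bool" where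
  "small A R B \<longleftrightarrow> B \<subseteq> A \<and> (\<forall>C\<in>A // R. finite (C \<inter> B))"

definition test_set ::
  "'c rel \<Rightarrow> nat \<Rightarrow> 'v::set_universe set \<Rightarrow> (nat \<Rightarrow> 'v rel) \<Rightarrow> 'v set set \<Rightarrow> bool" where
  "test_set \<theta> n A E \<M> \<longleftrightarrow>
     (\<forall>M\<in>\<M>. elementary_submodel M (hereditary \<theta>) \<and> vstruct n A E \<in> M) \<and>
     finite \<M> \<and> card \<M> = n - 1 \<and>
     strict_linear_order_on \<M> {(M, N). M \<in> \<M> \<and> N \<in> \<M> \<and> mem_as_set M N}"

definition twisted ::
  "'c rel \<Rightarrow> nat \<Rightarrow> 'v::set_universe set \<Rightarrow> (nat \<Rightarrow> 'v rel) \<Rightarrow> bool" where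
  "twisted \<theta> n A E \<longleftrightarrow> (\<forall>\<M>. test_set \<theta> n A E \<M> \<longrightarrow> (\<forall>k<n.
     small A (E k) {x \<in> A - \<Union>\<M>. \<forall>i<n. i \<noteq> k \<longrightarrow> mem_as_set (E i `` {x}) (\<Union>\<M>)}))"

end

theory Submission
  imports Defs
begin

text \<open>
  If the grid is not twisted, some \<open>E\<^sub>k\<close>-class contains infinitely many points \<open>x\<close> outside all
  models of a test set, whose other classes \<open>[x]\<^sub>i\<close> belong to models \<open>\<sigma> i\<close> that do not depend on \<open>x\<close>.
  Two classes in the same model would meet in a finite set contained in that model, so \<open>\<sigma>\<close> is
  injective. Choosing \<open>l\<close> of these points in general position gives a one-dimensional cube.

  A partial cube is enlarged in the direction \<open>j\<close> whose model is the largest remaining one: the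
  partial cube has no point in that model, but the \<open>E\<^sub>j\<close>-classes of its points are elements of
  it. By elementarity the model contains copies of the partial cube with points in the
  same \<open>E\<^sub>j\<close>-classes that avoid any given finite subset of the model. Points of different copies that
  are related by some \<open>E\<^sub>i\<close> with \<open>i \<noteq> j\<close> lie in finite sets of the form \<open>[x]\<^sub>i \<inter> [y]\<^sub>j\<close>, so \<open>l\<close> copies
  chosen one after the other form a cube with one more dimension.
\<close>

section \<open>Definability with parameters\<close>

primrec rename :: "(nat \<Rightarrow> nat) \<Rightarrow> fm \<Rightarrow> fm" where
  "rename h (Mem i j) = Mem (h i) (h j)"
| "rename h (Eq i j) = Eq (h i) (h j)"
| "rename h (Neg \<phi>) = Neg (rename h \<phi>)"
| "rename h (Conj \<phi> \<psi>) = Conj (rename h \<phi>) (rename h \<psi>)"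
| "rename h (Forall i \<phi>) = Forall (h i) (rename h \<phi>)"

text \<open>Injectivity prevents capture: when a quantifier reassigns \<open>h i\<close>, no other
  renamed variable changes with it.\<close>

lemma sat_rename:
  assumes "inj h"
  shows "sat N s (rename h \<phi>) \<longleftrightarrow> sat N (s \<circ> h) \<phi>"
proof (induction \<phi> arbitrary: s)
  case (Forall i \<phi>)
  have "s(h i := x) \<circ> h = (s \<circ> h)(i := x)" for x
    using assms by (auto simp: fun_eq_iff inj_def)
  then show ?case by (simp only: rename.simps sat.simps Forall.IH)
qed auto

text \<open>Bound variables are counted too: the aim is a finite set off which the assignment has no
  influence.\<close>

primrec vars :: "fm \<Rightarrow> nat set" where
  "vars (Mem i j) = {i, j}"
| "vars (Eq i j) = {i, j}"
| "vars (Neg \<phi>) = vars \<phi>"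
| "vars (Conj \<phi> \<psi>) = vars \<phi> \<union> vars \<psi>"
| "vars (Forall i \<phi>) = insert i (vars \<phi>)"

lemma finite_vars: "finite (vars \<phi>)"
  by (induction \<phi>) auto

lemma sat_cong_vars: "(\<And>i. i \<in> vars \<phi> \<Longrightarrow> s i = t i) \<Longrightarrow> sat N s \<phi> \<longleftrightarrow> sat N t \<phi>"
proof (induction \<phi> arbitrary: s t)
  case (Forall i \<phi>)
  have "sat N (s(i := x)) \<phi> \<longleftrightarrow> sat N (t(i := x)) \<phi>" for x
    by (rule Forall.IH) (use Forall.prems in auto)
  then show ?case by simp
next
  case (Conj \<phi> \<psi>)
  have "sat N s \<phi> \<longleftrightarrow> sat N t \<phi>" "sat N s \<psi> \<longleftrightarrow> sat N t \<psi>"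
    by (rule Conj.IH; use Conj.prems in simp)+
  then show ?case by simp
next
  case (Neg \<phi>)
  have "sat N s \<phi> \<longleftrightarrow> sat N t \<phi>"
    by (rule Neg.IH) (use Neg.prems in simp)
  then show ?case by simp
qed auto

fun exists_many :: "nat list \<Rightarrow> fm \<Rightarrow> fm" where
  "exists_many [] \<phi> = \<phi>"
| "exists_many (i # is) \<phi> = Neg (Forall i (Neg (exists_many is \<phi>)))"

lemma sat_exists_many:
  "sat N s (exists_many is \<phi>) \<longleftrightarrow>
     (\<exists>t. (\<forall>i. i \<notin> set is \<longrightarrow> t i = s i) \<and> (\<forall>i\<in>set is. t i \<in> N) \<and> sat N t \<phi>)"
proof (induction "is" arbitrary: s)
  case Nil
  have "(\<forall>i. t i = s i) \<longleftrightarrow> t = s" for t :: "nat \<Rightarrow> 'a"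
    by auto
  then show ?case by simp
next
  case (Cons j js)
  show ?case
  proof
    assume "sat N s (exists_many (j # js) \<phi>)"
    then obtain x where "x \<in> N" "sat N (s(j := x)) (exists_many js \<phi>)" by auto
    then obtain t where "\<forall>i. i \<notin> set js \<longrightarrow> t i = (s(j := x)) i" "\<forall>i\<in>set js. t i \<in> N" "sat N t \<phi>"
      using Cons by blast
    \<comment> \<open>If \<open>j\<close> recurs in \<open>js\<close>, an inner quantifier has
      overwritten \<open>x\<close>; otherwise \<open>t j = x\<close>.\<close>
    moreover have "t j \<in> N" using calculation \<open>x \<in> N\<close> by (cases "j \<in> set js") auto
    ultimately show "\<exists>t. (\<forall>i. i \<notin> set (j # js) \<longrightarrow> t i = s i) \<and>
        (\<forall>i\<in>set (j # js). t i \<in> N) \<and> sat N t \<phi>"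
      by (intro exI[of _ t]) auto
  next
    assume "\<exists>t. (\<forall>i. i \<notin> set (j # js) \<longrightarrow> t i = s i) \<and>
        (\<forall>i\<in>set (j # js). t i \<in> N) \<and> sat N t \<phi>"
    then obtain t where t: "\<forall>i. i \<notin> set (j # js) \<longrightarrow> t i = s i"
        "\<forall>i\<in>set (j # js). t i \<in> N" "sat N t \<phi>" by blast
    then have "sat N (s(j := t j)) (exists_many js \<phi>)"
      by (subst Cons) (intro exI[of _ t], auto)
    then show "sat N s (exists_many (j # js) \<phi>)" using t by auto
  qed
qed

text \<open>Even variables are the arguments of a definable predicate, odd ones its parameters.\<close>

definition interleave :: "(nat \<Rightarrow> 'v) \<Rightarrow> (nat \<Rightarrow> 'v) \<Rightarrow> nat \<Rightarrow> 'v" where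
  "interleave s p m = (if even m then s (m div 2) else p (m div 2))"

definition definable :: "'v::set_universe set \<Rightarrow> 'v set \<Rightarrow> ((nat \<Rightarrow> 'v) \<Rightarrow> bool) \<Rightarrow> bool" where
  "definable M N P \<longleftrightarrow> (\<exists>\<phi> p. range p \<subseteq> M \<and>
     (\<forall>s. range s \<subseteq> N \<longrightarrow> (P s \<longleftrightarrow> sat N (interleave s p) \<phi>)))"

lemma range_fun_upd_subset: "range s \<subseteq> N \<Longrightarrow> x \<in> N \<Longrightarrow> range (s(k := x)) \<subseteq> N"
  by auto

lemma fresh_variable:
  assumes "finite (K :: nat set)"
  obtains k where "k \<notin> K"
  using ex_new_if_finite[OF infinite_UNIV_nat assms] by blast

section \<open>Closure properties of definability, and reflection into the submodel\<close>

locale elementary_pair =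
  fixes M N :: "'v::set_universe set"
  assumes elementary: "elementary_submodel M N"
begin

abbreviation dfn :: "((nat \<Rightarrow> 'v) \<Rightarrow> bool) \<Rightarrow> bool" where
  "dfn \<equiv> definable M N"

lemma M_subset: "M \<subseteq> N" and M_nonempty: "M \<noteq> {}"
  using elementary by (auto simp: elementary_submodel_def)

lemma dfn_cong: "dfn P \<Longrightarrow> (\<And>s. range s \<subseteq> N \<Longrightarrow> Q s \<longleftrightarrow> P s) \<Longrightarrow> dfn Q"
  unfolding definable_def by simp

lemma dfn_mem_var: "dfn (\<lambda>s. s i \<in> elts (s j))"
proof -
  \<comment> \<open>The formula mentions no parameter; \<open>m\<close> only fills the parameter
    sequence, which must stay in \<open>M\<close>.\<close>
  obtain m where "m \<in> M" using M_nonempty by blast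
  then show ?thesis
    unfolding definable_def
    by (intro exI[of _ "Mem (2*i) (2*j)"] exI[of _ "\<lambda>_. m"]) (auto simp: interleave_def)
qed

lemma dfn_eq_var: "dfn (\<lambda>s. s i = s j)"
proof -
  obtain m where "m \<in> M" using M_nonempty by blast
  then show ?thesis
    unfolding definable_def
    by (intro exI[of _ "Eq (2*i) (2*j)"] exI[of _ "\<lambda>_. m"]) (auto simp: interleave_def)
qed

lemma dfn_eq_const: "c \<in> M \<Longrightarrow> dfn (\<lambda>s. s i = c)"
  \<comment> \<open>Variable \<open>1\<close> is the slot of parameter \<open>0\<close>.\<close>
  unfolding definable_def
  by (intro exI[of _ "Eq (2*i) 1"] exI[of _ "\<lambda>_. c"]) (auto simp: interleave_def)

lemma dfn_not: "dfn P \<Longrightarrow> dfn (\<lambda>s. \<not> P s)"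
  unfolding definable_def
proof (elim exE)
  fix \<phi> p
  assume "range p \<subseteq> M \<and> (\<forall>s. range s \<subseteq> N \<longrightarrow> P s = sat N (interleave s p) \<phi>)"
  then show "\<exists>\<phi> p. range p \<subseteq> M \<and>
      (\<forall>s. range s \<subseteq> N \<longrightarrow> (\<not> P s) = sat N (interleave s p) \<phi>)"
    by (intro exI[of _ "Neg \<phi>"] exI[of _ p]) auto
qed

lemma dfn_conj:
  assumes "dfn P" "dfn Q"
  shows "dfn (\<lambda>s. P s \<and> Q s)"
proof -
  obtain \<phi> p where p: "range p \<subseteq> M"
      "\<And>s. range s \<subseteq> N \<Longrightarrow> P s \<longleftrightarrow> sat N (interleave s p) \<phi>"
    using assms(1) unfolding definable_def by blast
  obtain \<psi> q where q: "range q \<subseteq> M"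
      "\<And>s. range s \<subseteq> N \<Longrightarrow> Q s \<longleftrightarrow> sat N (interleave s q) \<psi>"
    using assms(2) unfolding definable_def by blast
  \<comment> \<open>The parameter sequences are merged into \<open>interleave p q\<close>. Parameter
    \<open>b\<close> of \<open>p\<close> moves to place \<open>2b\<close>, so its variable
    \<open>m = 2b+1\<close> becomes \<open>4b+1 = 2m-1\<close>; parameter \<open>b\<close> of
    \<open>q\<close> moves to \<open>2b+1\<close>, so its variable becomes
    \<open>4b+3 = 2m+1\<close>. Argument variables stay.\<close>
  let ?h = "\<lambda>m :: nat. if even m then m else 2 * m - 1"
  let ?g = "\<lambda>m :: nat. if even m then m else 2 * m + 1"
  have inj: "inj ?h" "inj ?g"
    by (auto simp: inj_def elim!: oddE split: if_splits)
  have h: "interleave s (interleave p q) \<circ> ?h = interleave s p" for s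
  proof
    fix m :: nat
    have "(2 * m - 1) div 2 = m - 1" "odd m \<Longrightarrow> (m - 1) div 2 = m div 2" by presburger+
    then show "(interleave s (interleave p q) \<circ> ?h) m = interleave s p m"
      by (cases "even m") (auto simp: interleave_def elim: oddE)
  qed
  have g: "interleave s (interleave p q) \<circ> ?g = interleave s q" for s
    by (auto simp: fun_eq_iff interleave_def elim!: oddE)
  show ?thesis
    unfolding definable_def
  proof (intro exI[of _ "Conj (rename ?h \<phi>) (rename ?g \<psi>)"] exI[of _ "interleave p q"] conjI allI impI)
    show "range (interleave p q) \<subseteq> M" using p q by (auto simp: interleave_def)
    fix s :: "nat \<Rightarrow> 'v"
    assume "range s \<subseteq> N"
    then show "(P s \<and> Q s) \<longleftrightarrow>
        sat N (interleave s (interleave p q)) (Conj (rename ?h \<phi>) (rename ?g \<psi>))"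
      using p q by (simp only: sat.simps sat_rename[OF inj(1)] sat_rename[OF inj(2)] h g)
  qed
qed

lemma dfn_all:
  assumes "dfn P"
  shows "dfn (\<lambda>s. \<forall>x\<in>N. P (s(k := x)))"
proof -
  obtain \<phi> p where p: "range p \<subseteq> M"
      "\<And>s. range s \<subseteq> N \<Longrightarrow> P s \<longleftrightarrow> sat N (interleave s p) \<phi>"
    using assms unfolding definable_def by blast
  have upd: "interleave (s(k := x)) p = (interleave s p)(2 * k := x)" for s x
    by (auto simp: fun_eq_iff interleave_def)
  show ?thesis
    unfolding definable_def
  proof (intro exI[of _ "Forall (2 * k) \<phi>"] exI[of _ p] conjI allI impI)
    fix s :: "nat \<Rightarrow> 'v"
    assume "range s \<subseteq> N"
    then have "P (s(k := x)) \<longleftrightarrow> sat N ((interleave s p)(2 * k := x)) \<phi>" if "x \<in> N" for x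
      using p(2)[of "s(k := x)"] that by (simp only: upd range_fun_upd_subset)
    then show "(\<forall>x\<in>N. P (s(k := x))) \<longleftrightarrow> sat N (interleave s p) (Forall (2 * k) \<phi>)"
      by simp
  qed (use p in auto)
qed

lemma dfn_ex: "dfn P \<Longrightarrow> dfn (\<lambda>s. \<exists>x\<in>N. P (s(k := x)))"
  using dfn_not[OF dfn_all[OF dfn_not]] by simp

lemma dfn_disj: "dfn P \<Longrightarrow> dfn Q \<Longrightarrow> dfn (\<lambda>s. P s \<or> Q s)"
  using dfn_not[OF dfn_conj[OF dfn_not dfn_not]] by simp

lemma dfn_iff: "dfn P \<Longrightarrow> dfn Q \<Longrightarrow> dfn (\<lambda>s. P s \<longleftrightarrow> Q s)"
  by (rule dfn_cong[OF dfn_disj[OF dfn_conj dfn_conj[OF dfn_not dfn_not]], of P Q P Q]) auto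

lemma dfn_True: "dfn (\<lambda>_. True)"
  by (rule dfn_cong[OF dfn_eq_var[of 0 0]]) simp

text \<open>This is a finite conjunction formed outside the language, so each \<open>P i\<close> may
  have its own formula and parameters.\<close>

lemma dfn_ball:
  "finite K \<Longrightarrow> (\<And>i. i \<in> K \<Longrightarrow> dfn (P i)) \<Longrightarrow> dfn (\<lambda>s. \<forall>i\<in>K. P i s)"
  by (induction K rule: finite_induct) (simp_all add: dfn_True dfn_conj)

lemma dfn_if_const: "dfn P \<Longrightarrow> dfn (\<lambda>s. P s \<longleftrightarrow> b)"
  by (cases b) (simp_all add: dfn_not)

text \<open>An argument becomes a constant by quantifying it existentially and equating it with a
  parameter.\<close>

lemma dfn_subst:
  assumes "dfn P" "c \<in> M"
  shows "dfn (\<lambda>s. P (s(k := c)))"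
  by (rule dfn_cong[OF dfn_ex[OF dfn_conj[OF dfn_eq_const[OF assms(2), of k] assms(1)], of k]])
    (use assms(2) M_subset in auto)

lemma dfn_mem_const: "c \<in> M \<Longrightarrow> dfn (\<lambda>s. s i \<in> elts c)"
  using dfn_subst[OF dfn_mem_var[of i "Suc i"], of c "Suc i"] by simp

text \<open>Elementarity in the form used below: the finitely many arguments that the formula
  mentions are quantified existentially, and witnesses are found in \<open>M\<close>.\<close>

lemma reflect:
  assumes "dfn P" "range s \<subseteq> N" "P s"
  obtains t where "range t \<subseteq> M" "P t"
proof -
  obtain \<phi> p where p: "range p \<subseteq> M"
      "\<And>s. range s \<subseteq> N \<Longrightarrow> P s \<longleftrightarrow> sat N (interleave s p) \<phi>"
    using assms unfolding definable_def by blast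
  obtain m where m: "m \<in> M" using M_nonempty by blast
  obtain K where K: "set K = {i \<in> vars \<phi>. even i}"
    using finite_list[of "{i \<in> vars \<phi>. even i}"] finite_vars[of \<phi>] by auto
  \<comment> \<open>\<open>?s0\<close> lies in \<open>M\<close> and carries the right parameters
    with dummy arguments; \<open>?s1\<close> restores the values of \<open>s\<close> on the
    variables of the formula, so the two differ at most on \<open>K\<close>.\<close>
  let ?s0 = "interleave (\<lambda>_. m) p"
  let ?s1 = "\<lambda>i. if i \<in> vars \<phi> then interleave s p i else ?s0 i"
  have s0: "\<forall>i. ?s0 i \<in> M" using m p by (auto simp: interleave_def)
  have "sat N (interleave s p) \<phi>" using assms p by blast
  then have "sat N ?s1 \<phi>" by (subst sat_cong_vars[where t = "interleave s p"]) auto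
  moreover have "\<forall>i. i \<notin> set K \<longrightarrow> ?s1 i = ?s0 i" using K by (auto simp: interleave_def)
  moreover have "\<forall>i\<in>set K. ?s1 i \<in> N" using K assms(2) by (auto simp: interleave_def)
  ultimately have "sat N ?s0 (exists_many K \<phi>)"
    by (subst sat_exists_many) (intro exI[of _ ?s1] conjI)
  \<comment> \<open>Elementarity takes the existential statement down to \<open>M\<close>;
    afterwards it takes the matrix, now true of \<open>t\<close>, back to \<open>N\<close>.\<close>
  then have "sat M ?s0 (exists_many K \<phi>)"
    using elementary s0 unfolding elementary_submodel_def by blast
  then obtain t where t: "\<forall>i. i \<notin> set K \<longrightarrow> t i = ?s0 i" "\<forall>i\<in>set K. t i \<in> M" "sat M t \<phi>"
    by (auto simp: sat_exists_many)
  have tM: "\<forall>i. t i \<in> M" using t s0 by metis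
  then have sat: "sat N t \<phi>"
    using elementary t(3) unfolding elementary_submodel_def by blast
  \<comment> \<open>Only even variables were reassigned, so the odd places of \<open>t\<close> still
    hold the parameters \<open>p\<close>.\<close>
  have "interleave (\<lambda>i. t (2 * i)) p = t"
    using t K by (auto simp: fun_eq_iff interleave_def elim!: oddE evenE)
  then have "P (\<lambda>i. t (2 * i))"
    using p(2)[of "\<lambda>i. t (2 * i)"] tM sat M_subset by auto
  then show thesis using that[of "\<lambda>i. t (2 * i)"] tM by auto
qed

text \<open>If an element lay outside \<open>M\<close>, then satisfying \<open>P\<close> and
  differing from each of the finitely many solutions in \<open>M\<close> would be possible, and by
  reflection possible inside \<open>M\<close>, which is absurd. The hypothesis \<open>indep\<close>
  makes \<open>P\<close> a condition on argument \<open>0\<close> alone.\<close>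

lemma finite_definable_subset:
  assumes "dfn P" "finite {x \<in> N. P (\<lambda>_. x)}"
    and indep: "\<And>s. P s \<longleftrightarrow> P (\<lambda>_. s 0)"
  shows "{x \<in> N. P (\<lambda>_. x)} \<subseteq> M"
proof (rule ccontr)
  let ?Z = "{x \<in> N. P (\<lambda>_. x)} \<inter> M"
  assume "\<not> ?thesis"
  then obtain x where x: "x \<in> N" "P (\<lambda>_. x)" "x \<notin> M" by blast
  have "dfn (\<lambda>s. P s \<and> (\<forall>z\<in>?Z. \<not> s 0 = z))"
    by (intro dfn_conj assms dfn_ball dfn_not dfn_eq_const finite_Int disjI1) auto
  then obtain t where "range t \<subseteq> M" "P t \<and> (\<forall>z\<in>?Z. \<not> t 0 = z)"
    by (rule reflect[where s = "\<lambda>_. x"]) (use x in auto)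
  then show False using indep[of t] M_subset by auto
qed

end

section \<open>Sets of small hereditary cardinality\<close>

lemma trcl_mem: "y \<in> elts x \<Longrightarrow> y \<in> trcl x"
  by (auto simp: trcl_def)

lemma trcl_mono: "y \<in> elts x \<Longrightarrow> trcl y \<subseteq> trcl x"
  by (auto simp: trcl_def intro: trancl_into_trancl)

lemma trcl_unfold: "trcl x = elts x \<union> (\<Union>y\<in>elts x. trcl y)"
proof
  show "trcl x \<subseteq> elts x \<union> (\<Union>y\<in>elts x. trcl y)"
  proof
    fix z assume "z \<in> trcl x"
    then have "(z, x) \<in> {(u, v). u \<in> elts v}\<^sup>+" by (simp add: trcl_def)
    then show "z \<in> elts x \<union> (\<Union>y\<in>elts x. trcl y)"
      by (cases rule: trancl.cases) (auto simp: trcl_def)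
  qed
qed (use trcl_mem trcl_mono in blast)

lemma vset_elts: "vset (elts v) = v"
  unfolding vset_def by (rule the_equality) (auto intro: elts_inject)

lemma hereditary_transitive:
  assumes "x \<in> hereditary \<theta>" "y \<in> elts x"
  shows "y \<in> hereditary \<theta>"
  using assms card_of_mono1[OF trcl_mono[OF assms(2)]]
  by (auto simp: hereditary_def intro: ordLeq_ordLess_trans)

locale hereditary_universe =
  fixes \<theta> :: "'c rel" and univ :: "'v::set_universe itself"
  assumes regular: "regular_uncountable \<theta>"
    and closed: "contains_all_hereditary univ \<theta>"
begin

abbreviation H :: "'v set" where "H \<equiv> hereditary \<theta>"

lemma Cinfinite: "Cinfinite \<theta>"
  using regular cinfinite_mono[OF ordLess_imp_ordLeq natLeq_cinfinite]
  by (auto simp: regular_uncountable_def)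

lemma finite_ordLess: "finite X \<Longrightarrow> |X| <o \<theta>"
  using finite_ordLess_infinite[OF card_of_Well_order, of \<theta> X] Cinfinite
  by (auto simp: cinfinite_def Field_card_of card_order_on_def)

text \<open>The closure assumption supplies the set. Regularity bounds its transitive closure, a
  union of fewer than \<open>\<theta>\<close> sets of size below \<open>\<theta>\<close>.\<close>

lemma vset_hereditary:
  assumes "X \<subseteq> H" "|X| <o \<theta>"
  shows elts_vset: "elts (vset X) = X" and vset_in_hereditary: "vset X \<in> H"
proof -
  obtain v where v: "elts v = X"
    using closed assms unfolding contains_all_hereditary_def by (metis rangeE)
  then show X: "elts (vset X) = X" using vset_elts[of v] by simp
  have "|\<Union>x\<in>X. trcl x| <o \<theta>"
    using regular Cinfinite assms
    by (intro card_of_UNION_ordLess_infinite_Field_regularCard)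
      (auto simp: regular_uncountable_def hereditary_def)
  then have "|X \<union> (\<Union>x\<in>X. trcl x)| <o \<theta>"
    using assms(2) Cinfinite by (intro card_of_Un_ordLess_infinite_Field) (auto simp: cinfinite_def)
  then show "vset X \<in> H" by (simp add: hereditary_def trcl_unfold[of "vset X"] X)
qed

lemma elts_ordLess: "v \<in> H \<Longrightarrow> |elts v| <o \<theta>"
  using card_of_mono1[of "elts v" "trcl v"] trcl_mem
  by (auto simp: hereditary_def intro: ordLeq_ordLess_trans)

lemma vset_finite:
  "X \<subseteq> H \<Longrightarrow> finite X \<Longrightarrow> elts (vset X) = X \<and> vset X \<in> H"
  by (simp add: finite_ordLess vset_hereditary)

lemma vpair_hereditary:
  assumes "x \<in> H" "y \<in> H"
  shows vpair_in_hereditary: "vpair x y \<in> H"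
    and elts_vpair: "elts (vpair x y) = {vset {x}, vset {x, y}}"
  using assms vset_finite[of "{x}"] vset_finite[of "{x, y}"]
    vset_finite[of "{vset {x}, vset {x, y}}"]
  by (auto simp: vpair_def)

lemma vset_singleton: "x \<in> H \<Longrightarrow> elts (vset {x}) = {x} \<and> vset {x} \<in> H"
  and vset_doubleton: "x \<in> H \<Longrightarrow> y \<in> H \<Longrightarrow> elts (vset {x, y}) = {x, y} \<and> vset {x, y} \<in> H"
  by (simp_all add: vset_finite)

text \<open>This unfolds the Kuratowski pair into unordered pairs with quantifiers over
  \<open>H\<close>, ready for definability. Writing the singleton as \<open>{x, x}\<close> lets one
  formula for unordered pairs serve all three equations.\<close>

lemma eq_vpair_iff:
  assumes "p \<in> H" "x \<in> H" "y \<in> H"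
  shows "p = vpair x y \<longleftrightarrow>
    (\<exists>u\<in>H. \<exists>v\<in>H. elts u = {x, x} \<and> elts v = {x, y} \<and> elts p = {u, v})"
proof
  assume "p = vpair x y"
  then show "\<exists>u\<in>H. \<exists>v\<in>H. elts u = {x, x} \<and> elts v = {x, y} \<and> elts p = {u, v}"
    using assms vset_singleton[of x] vset_doubleton[of x y]
    by (intro bexI[of _ "vset {x}"] bexI[of _ "vset {x, y}"]) (auto simp: elts_vpair)
next
  assume "\<exists>u\<in>H. \<exists>v\<in>H. elts u = {x, x} \<and> elts v = {x, y} \<and> elts p = {u, v}"
  then obtain u v where uv: "elts u = {x}" "elts v = {x, y}" "elts p = {u, v}" by auto
  then have "u = vset {x}" "v = vset {x, y}" using vset_elts by metis+
  then show "p = vpair x y"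
    using uv by (intro elts_inject) (simp add: elts_vpair assms)
qed

lemma vpair_inject:
  assumes "x \<in> H" "y \<in> H" "x' \<in> H" "y' \<in> H"
  shows "vpair x y = vpair x' y' \<longleftrightarrow> x = x' \<and> y = y'"
proof
  assume "vpair x y = vpair x' y'"
  then have *: "{vset {x}, vset {x, y}} = {vset {x'}, vset {x', y'}}"
    using assms elts_vpair by metis
  \<comment> \<open>Taking extensions reduces the claim to Kuratowski pairs of HOL sets.\<close>
  have "elts ` {vset {x}, vset {x, y}} = {{x}, {x, y}}"
       "elts ` {vset {x'}, vset {x', y'}} = {{x'}, {x', y'}}"
    using assms by (simp_all add: vset_singleton vset_doubleton)
  then have "{{x}, {x, y}} = {{x'}, {x', y'}}" using * by metis
  then show "x = x' \<and> y = y'" by (auto simp: doubleton_eq_iff)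
qed simp

lemma vnat_in_hereditary: "vnat k \<in> H"
proof (induction k)
  case 0
  then show ?case using vset_finite[of "{}"] by simp
next
  case (Suc k)
  have "|insert (vnat k) (elts (vnat k :: 'v))| <o \<theta>"
    using card_of_Un_ordLess_infinite_Field[of \<theta> "{vnat k :: 'v}" "elts (vnat k)"]
      elts_ordLess[OF Suc] finite_ordLess[of "{vnat k :: 'v}"] Cinfinite
    by (auto simp: cinfinite_def)
  then show ?case
    using Suc hereditary_transitive[OF Suc] by (auto intro!: vset_in_hereditary)
qed

lemma vrel_hereditary:
  assumes "a \<in> H" "R \<subseteq> elts a \<times> elts a"
  shows elts_vrel: "elts (vrel R) = {vpair x y | x y. (x, y) \<in> R}"
    and vrel_in_hereditary: "vrel R \<in> H"
proof -
  let ?X = "(\<lambda>(x, y). vpair x y) ` R"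
  have eq: "{vpair x y | x y. (x, y) \<in> R} = ?X" by auto
  have "?X \<subseteq> H" using assms hereditary_transitive[OF assms(1)] vpair_in_hereditary by auto
  moreover have "|?X| <o \<theta>"
  proof -
    \<comment> \<open>The square is a union of \<open>elts a\<close> many rows, so regularity
      applies again.\<close>
    have "|elts a \<times> elts a| <o \<theta>"
    proof -
      have "|Pair x ` elts a| <o \<theta>" for x :: 'v
        using card_of_image elts_ordLess[OF assms(1)] by (rule ordLeq_ordLess_trans)
      then have "|\<Union>x\<in>elts a. Pair x ` elts a| <o \<theta>"
        using regular Cinfinite elts_ordLess[OF assms(1)]
        by (intro card_of_UNION_ordLess_infinite_Field_regularCard)
          (auto simp: regular_uncountable_def)
      moreover have "(\<Union>x\<in>elts a. Pair x ` elts a) = elts a \<times> elts a" by auto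
      ultimately show ?thesis by simp
    qed
    moreover have "|?X| \<le>o |elts a \<times> elts a|"
      using card_of_image[of "\<lambda>(x, y). vpair x y" R] card_of_mono1[OF assms(2)]
        ordLeq_transitive by blast
    ultimately show ?thesis by (rule ordLeq_ordLess_trans[rotated])
  qed
  ultimately show "elts (vrel R) = {vpair x y | x y. (x, y) \<in> R}" "vrel R \<in> H"
    unfolding vrel_def eq by (rule vset_hereditary)+
qed

lemma vpair_mem_vrel:
  assumes "a \<in> H" "R \<subseteq> elts a \<times> elts a" "x \<in> H" "y \<in> H"
  shows "vpair x y \<in> elts (vrel R) \<longleftrightarrow> (x, y) \<in> R"
proof -
  have "u \<in> H \<and> v \<in> H" if "(u, v) \<in> R" for u v
    using that assms hereditary_transitive[OF assms(1)] by blast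
  then show ?thesis using assms by (auto simp: elts_vrel[OF assms(1,2)] vpair_inject)
qed

end

section \<open>Pairs, relations and classes definable inside a submodel of \<open>H\<close>\<close>

locale elementary_hereditary = hereditary_universe \<theta> univ + elementary_pair M "hereditary \<theta>"
  for \<theta> :: "'c rel" and univ :: "'v::set_universe itself" and M :: "'v set"
begin

lemma dfn_elts_doubleton: "dfn (\<lambda>s. elts (s i) = {s j, s k})"
proof -
  obtain m where m: "m \<notin> {i, j, k}" by (rule fresh_variable[of "{i, j, k}"]) auto
  have "dfn (\<lambda>s. \<forall>x\<in>H. (s(m := x)) m \<in> elts ((s(m := x)) i) \<longleftrightarrow>
      (s(m := x)) m = (s(m := x)) j \<or> (s(m := x)) m = (s(m := x)) k)"
    by (rule dfn_all[OF dfn_iff[OF dfn_mem_var dfn_disj[OF dfn_eq_var dfn_eq_var]]])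
  then show ?thesis
    \<comment> \<open>By transitivity of \<open>H\<close>, a quantifier over \<open>H\<close> sees
      every element of \<open>s i\<close>.\<close>
    by (rule dfn_cong) (use m in \<open>auto intro: hereditary_transitive\<close>)
qed

lemma dfn_eq_vpair: "dfn (\<lambda>s. s i = vpair (s j) (s k))"
proof -
  obtain u where u: "u \<notin> {i, j, k}" by (rule fresh_variable[of "{i, j, k}"]) auto
  obtain v where v: "v \<notin> {u, i, j, k}" by (rule fresh_variable[of "{u, i, j, k}"]) auto
  let ?Q = "\<lambda>s. elts (s u) = {s j, s j} \<and> elts (s v) = {s j, s k} \<and> elts (s i) = {s u, s v}"
  have "dfn (\<lambda>s. \<exists>x\<in>H. \<exists>y\<in>H. ?Q (s(u := x, v := y)))"
    by (rule dfn_ex[OF dfn_ex]) (intro dfn_conj dfn_elts_doubleton)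
  then show ?thesis
    by (rule dfn_cong) (use u v in \<open>simp add: eq_vpair_iff image_subset_iff\<close>)
qed

text \<open>Reflection yields a solution with entries in \<open>M\<close>, and its entry
  \<open>0\<close> can only be \<open>c\<close>.\<close>

lemma unique_in_M:
  assumes "dfn P" "range s \<subseteq> H" "P s" "\<And>t. range t \<subseteq> H \<Longrightarrow> P t \<Longrightarrow> t 0 = c"
  shows "c \<in> M"
proof -
  obtain t where "range t \<subseteq> M" "P t" by (rule reflect[OF assms(1-3)])
  then show ?thesis using assms(4)[of t] M_subset by auto
qed

lemma vpair_snd_in_M:
  assumes "vpair x y \<in> M" "x \<in> H" "y \<in> H"
  shows "y \<in> M"
proof (rule unique_in_M)
  have "dfn (\<lambda>s. (s(2 := vpair x y)) 2 = vpair ((s(2 := vpair x y)) 1) ((s(2 := vpair x y)) 0))"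
    by (rule dfn_subst[OF dfn_eq_vpair assms(1)])
  then show "dfn (\<lambda>s. vpair x y = vpair (s 1) (s 0))" by simp
  \<comment> \<open>Argument \<open>0\<close> stands for the second component and argument
    \<open>1\<close> for the first; the only parameter is the pair.\<close>
  show "range (\<lambda>i :: nat. if i = 0 then y else x) \<subseteq> H" using assms by auto
qed (use assms in \<open>auto simp: vpair_inject image_subset_iff\<close>)

lemma finite_elts_subset:
  assumes "c \<in> M" "finite (elts c)"
  shows "elts c \<subseteq> M"
proof -
  have "{x \<in> H. x \<in> elts c} \<subseteq> M"
    by (rule finite_definable_subset[OF dfn_mem_const[OF assms(1), of 0]]) (use assms in auto)
  then show ?thesis using assms M_subset hereditary_transitive by blast
qed

text \<open>The code of the structure is peeled off: its second component is the function sending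
  \<open>i\<close> to \<open>E i\<close>. As a finite set in \<open>M\<close> this function has all
  its pairs in \<open>M\<close>, hence their second components as well.\<close>

lemma vrel_in_M:
  assumes "a \<in> H" "\<And>i. i < n \<Longrightarrow> E i \<subseteq> elts a \<times> elts a" "vstruct n (elts a) E \<in> M"
  shows "\<And>i. i < n \<Longrightarrow> vrel (E i) \<in> M"
proof -
  let ?X = "(\<lambda>i. vpair (vnat i) (vrel (E i)) :: 'v) ` {..<n}"
  have eq: "{vpair (vnat i) (vrel (E i)) | i. i < n} = ?X" by auto
  have rel: "vrel (E i) \<in> H" if "i < n" for i
    using vrel_in_hereditary[OF assms(1) assms(2)[OF that]] .
  then have X: "elts (vset ?X) = ?X" "vset ?X \<in> H"
    using vset_finite[of ?X] vpair_in_hereditary[OF vnat_in_hereditary rel] by blast+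
  have str: "vpair a (vset ?X) \<in> M"
    using assms(3) by (simp add: vstruct_def eq vset_elts)
  have "vset ?X \<in> M" by (rule vpair_snd_in_M[OF str assms(1) X(2)])
  then have "?X \<subseteq> M" using finite_elts_subset[of "vset ?X"] X by simp
  then show "vrel (E i) \<in> M" if "i < n" for i
    using that vpair_snd_in_M[OF _ vnat_in_hereditary rel] by blast
qed

lemma dfn_rel:
  assumes "a \<in> H" "R \<subseteq> elts a \<times> elts a" "vrel R \<in> M"
  shows "dfn (\<lambda>s. (s i, s j) \<in> R)"
proof -
  obtain k where k: "k \<notin> {i, j}" by (rule fresh_variable[of "{i, j}"]) auto
  have "dfn (\<lambda>s. \<exists>p\<in>H. (s(k := p)) k \<in> elts (vrel R) \<and>
      (s(k := p)) k = vpair ((s(k := p)) i) ((s(k := p)) j))"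
    by (rule dfn_ex[OF dfn_conj[OF dfn_mem_const[OF assms(3)] dfn_eq_vpair]])
  then show ?thesis
  proof (rule dfn_cong)
    fix s :: "nat \<Rightarrow> 'v"
    assume "range s \<subseteq> H"
    then have "s i \<in> H" "s j \<in> H" by auto
    then show "(s i, s j) \<in> R \<longleftrightarrow> (\<exists>p\<in>H. (s(k := p)) k \<in> elts (vrel R) \<and>
        (s(k := p)) k = vpair ((s(k := p)) i) ((s(k := p)) j))"
      using k vpair_mem_vrel[OF assms(1,2)] vpair_in_hereditary by auto
  qed
qed

text \<open>When \<open>m\<close> codes another model, this makes membership of the class of a point
  in that model a first-order condition.\<close>

lemma dfn_class_mem:
  assumes "a \<in> H" "R \<subseteq> elts a \<times> elts a" "vrel R \<in> M" "m \<in> M"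
  shows "dfn (\<lambda>s. mem_as_set (R `` {s i}) (elts m))"
proof -
  obtain u where u: "u \<notin> {i}" by (rule fresh_variable[of "{i}"]) auto
  obtain v where v: "v \<notin> {u, i}" by (rule fresh_variable[of "{u, i}"]) auto
  let ?Q = "\<lambda>s. \<forall>y\<in>H. (s(v := y)) v \<in> elts ((s(v := y)) u) \<longleftrightarrow> ((s(v := y)) i, (s(v := y)) v) \<in> R"
  have "dfn (\<lambda>s. \<exists>x\<in>H. (s(u := x)) u \<in> elts m \<and> ?Q (s(u := x)))"
    by (rule dfn_ex[OF dfn_conj[OF dfn_mem_const[OF assms(4)]
          dfn_all[OF dfn_iff[OF dfn_mem_var dfn_rel[OF assms(1-3)]]]]])
  then show ?thesis
  proof (rule dfn_cong)
    fix s :: "nat \<Rightarrow> 'v"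
    have m: "x \<in> H" if "x \<in> elts m" for x
      using that assms(4) M_subset hereditary_transitive by blast
    have "elts x = R `` {s i} \<longleftrightarrow> (\<forall>y\<in>H. y \<in> elts x \<longleftrightarrow> (s i, y) \<in> R)" if "x \<in> elts m" for x
      using hereditary_transitive[OF m[OF that]] hereditary_transitive[OF assms(1)] assms(2) by auto
    then show "mem_as_set (R `` {s i}) (elts m) \<longleftrightarrow>
        (\<exists>x\<in>H. (s(u := x)) u \<in> elts m \<and> ?Q (s(u := x)))"
      using u v m by (auto simp: mem_as_set_def)
  qed
qed

end

section \<open>Partial cubes\<close>

text \<open>Greedy choice: the hypothesis provides a next element compatible with any finite set of
  earlier ones.\<close>

lemma choose_sequence:
  assumes "\<And>T. finite T \<Longrightarrow> T \<subseteq> X \<Longrightarrow> \<exists>g\<in>X. \<forall>h\<in>T. R h g"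
  shows "\<exists>G :: nat \<Rightarrow> 'a. \<forall>r<l. G r \<in> X \<and> (\<forall>q<r. R (G q) (G r))"
proof (induction l)
  case 0
  then show ?case by simp
next
  case (Suc l)
  then obtain G where G: "\<forall>r<l. G r \<in> X \<and> (\<forall>q<r. R (G q) (G r))" by blast
  then obtain g where "g \<in> X" "\<forall>h\<in>G ` {..<l}. R h g"
    using assms[of "G ` {..<l}"] by blast
  then show ?case
    using G by (intro exI[of _ "G(l := g)"]) (auto simp: less_Suc_eq)
qed

text \<open>The grid axiom speaks of two classes of one point; classes of \<open>x\<close> and
  \<open>y\<close> that meet are both classes of a common point \<open>z\<close>.\<close>

lemma grid_finite_Int:
  assumes "grid n A E" "i < n" "j < n" "i \<noteq> j"
  shows "finite (E i `` {x} \<inter> E j `` {y})"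
proof (cases "E i `` {x} \<inter> E j `` {y} = {}")
  case False
  then obtain z where z: "(x, z) \<in> E i" "(y, z) \<in> E j" by blast
  have eq: "equiv A (E i)" "equiv A (E j)" using assms by (auto simp: grid_def)
  have "E i `` {x} = E i `` {z}" "E j `` {y} = E j `` {z}"
    using z eq equiv_class_eq by metis+
  moreover have "z \<in> A" using z eq by (auto simp: equiv_def)
  ultimately show ?thesis
    using assms(1-4) unfolding grid_def by (metis Int_commute linorder_neqE_nat)
qed auto

text \<open>The coordinates in \<open>I\<close> are those not yet built; the models \<open>M i\<close> for \<open>i \<in> I\<close> witness that
  they still can be.\<close>

definition partial_cube ::
  "nat \<Rightarrow> 'v::set_universe set \<Rightarrow> (nat \<Rightarrow> 'v rel) \<Rightarrow> nat \<Rightarrow> (nat \<Rightarrow> 'v set) \<Rightarrow> nat set \<Rightarrow>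
     ((nat \<Rightarrow> nat) \<Rightarrow> 'v) \<Rightarrow> bool" where
  "partial_cube n A E l M I f \<longleftrightarrow>
     (\<forall>p\<in>PiE ({..<n} - I) (\<lambda>_. {..<l}).
        f p \<in> A \<and> (\<forall>i\<in>I. f p \<notin> M i \<and> mem_as_set (E i `` {f p}) (M i))) \<and>
     (\<forall>p\<in>PiE ({..<n} - I) (\<lambda>_. {..<l}). \<forall>q\<in>PiE ({..<n} - I) (\<lambda>_. {..<l}). \<forall>i\<in>{..<n}.
        (f p, f q) \<in> E i \<longleftrightarrow> (\<forall>j\<in>{..<n} - I - {i}. p j = q j))"

lemma partial_cube_grid_embedding:
  assumes "partial_cube n A E l M {} f" "n \<ge> 2" "grid n A E"
  shows "grid_embedding n (cube_carrier n (\<lambda>_. {..<l})) (cube_rel n (\<lambda>_. {..<l})) A E f"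
proof -
  let ?D = "cube_carrier n (\<lambda>_. {..<l :: nat})"
  have f: "\<And>p. p \<in> ?D \<Longrightarrow> f p \<in> A"
    and rel: "\<And>p q i. p \<in> ?D \<Longrightarrow> q \<in> ?D \<Longrightarrow> i < n \<Longrightarrow>
      (f p, f q) \<in> E i \<longleftrightarrow> (\<forall>j\<in>{..<n} - {i}. p j = q j)"
    using assms(1) by (auto simp: partial_cube_def cube_carrier_def)
  have "p = q" if pq: "p \<in> ?D" "q \<in> ?D" "f p = f q" for p q
  proof -
    have "(f p, f q) \<in> E i" if "i < n" for i
      using assms(3) that f pq by (auto simp: grid_def equiv_def refl_on_def)
    then have *: "p j = q j" if "i < n" "j < n" "j \<noteq> i" for i j
      using rel[OF pq(1,2)] that by blast
    \<comment> \<open>\<open>E 0\<close> settles every coordinate except \<open>0\<close>, and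
      \<open>E 1\<close> settles coordinate \<open>0\<close>; here \<open>n \<ge> 2\<close>
      enters.\<close>
    have "p j = q j" if "j < n" for j
      using *[of 0 j] *[of 1 j] that assms(2) by (cases "j = 0") auto
    then show "p = q"
      using pq unfolding cube_carrier_def by (intro PiE_ext) auto
  qed
  then have "inj_on f ?D" by (intro inj_onI)
  then show ?thesis
    using f rel by (auto simp: grid_embedding_def cube_rel_def)
qed

section \<open>Enlarging a partial cube by further directions\<close>

context hereditary_universe
begin

text \<open>Since the other remaining models are elements of \<open>M j\<close>, the requirements
  they impose are definable with parameters in \<open>M j\<close>.\<close>

lemma partial_cube_extend:
  fixes a :: 'v
  assumes a: "a \<in> H" "A = elts a" and grid: "grid n A E"
    and I: "I \<subseteq> {..<n}" "j \<in> I"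
    and M: "elementary_submodel (M j) H" "vstruct n A E \<in> M j"
    and mem: "\<And>i. i \<in> I - {j} \<Longrightarrow> mem_as_set (M i) (M j)"
    and f: "partial_cube n A E l M I f"
  shows "\<exists>g. partial_cube n A E l M (I - {j}) g"
proof -
  interpret elementary_hereditary \<theta> univ "M j" by unfold_locales (rule M)
  define D where "D = PiE ({..<n} - I) (\<lambda>_. {..<l :: nat})"
  have jn: "j < n" using I by auto
  have eq: "equiv A (E i)" if "i < n" for i using grid that by (auto simp: grid_def)
  have sub: "E i \<subseteq> elts a \<times> elts a" if "i < n" for i
    using eq[OF that] a by (simp add: equiv_def)
  have vrel: "vrel (E i) \<in> M j" if "i < n" for i
    using vrel_in_M[where n = n and E = E, OF a(1) sub _ that] M a by simp
  have AH: "A \<subseteq> H" using a hereditary_transitive by blast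
  have f1: "f p \<in> A" "f p \<notin> M i" "mem_as_set (E i `` {f p}) (M i)" if "p \<in> D" "i \<in> I" for p i
    using f that by (auto simp: partial_cube_def D_def)
  have f2: "(f p, f q) \<in> E i \<longleftrightarrow> (\<forall>j\<in>{..<n} - I - {i}. p j = q j)"
    if "p \<in> D" "q \<in> D" "i < n" for p q i
    using f that by (auto simp: partial_cube_def D_def)
  have finD: "finite D" by (auto simp: D_def intro: finite_PiE)
  \<comment> \<open>The numbering \<open>v\<close> of the positions lets a whole copy of the cube be
    read as one assignment.\<close>
  then obtain v :: "_ \<Rightarrow> nat" where v: "inj_on v D"
    using finite_imp_inj_to_nat_seg by blast
  have "\<forall>p\<in>D. \<exists>c\<in>M j. elts c = E j `` {f p}"
    using f1(3) I by (auto simp: mem_as_set_def)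
  then obtain c where c: "\<And>p. p \<in> D \<Longrightarrow> c p \<in> M j" "\<And>p. p \<in> D \<Longrightarrow> elts (c p) = E j `` {f p}"
    by metis
  have "\<forall>i\<in>I - {j}. \<exists>m\<in>M j. elts m = M i"
    using mem by (auto simp: mem_as_set_def)
  then obtain m where m: "\<And>i. i \<in> I - {j} \<Longrightarrow> m i \<in> M j" "\<And>i. i \<in> I - {j} \<Longrightarrow> elts (m i) = M i"
    by metis
  \<comment> \<open>A good \<open>g\<close> is a copy of the partial cube in the same
    \<open>E j\<close>-classes that keeps the conditions for \<open>I - {j}\<close>. The codes
    \<open>c p\<close> and \<open>m i\<close> in \<open>M j\<close> make this definable
    there.\<close>
  define good where "good g \<longleftrightarrow>
      (\<forall>p\<in>D. g p \<in> elts (c p) \<and>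
        (\<forall>i\<in>I - {j}. \<not> g p \<in> elts (m i) \<and> mem_as_set (E i `` {g p}) (elts (m i)))) \<and>
      (\<forall>p\<in>D. \<forall>q\<in>D. \<forall>i\<in>{..<n}. (g p, g q) \<in> E i \<longleftrightarrow> (\<forall>j\<in>{..<n} - I - {i}. p j = q j))"
    for g :: "(nat \<Rightarrow> nat) \<Rightarrow> 'v"
  define X where "X = {g. good g \<and> g ` D \<subseteq> M j}"
  define R where "R h g \<longleftrightarrow> (\<forall>p\<in>D. \<forall>q\<in>D. \<forall>i\<in>{..<n} - {j}. (h q, g p) \<notin> E i)"
    for h g :: "(nat \<Rightarrow> nat) \<Rightarrow> 'v"
  have dfn_good: "dfn (\<lambda>s. good (\<lambda>p. s (v p)))"
    unfolding good_def
    using I finite_subset[OF I(1)]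
    by (intro dfn_conj dfn_ball dfn_not dfn_if_const dfn_mem_const dfn_class_mem[OF a(1)]
        dfn_rel[OF a(1)] c m sub vrel finD) auto
  have "\<exists>g\<in>X. \<forall>h\<in>T. R h g" if T: "finite T" "T \<subseteq> X" for T
  proof -
    \<comment> \<open>\<open>W h p q i\<close> collects the forbidden values at position
      \<open>p\<close>, those \<open>E i\<close>-related to the point \<open>h q\<close> of an
      earlier copy. It is finite by the grid axiom and definable over \<open>M j\<close>, so it lies
      inside \<open>M j\<close>.\<close>
    define W where "W h p q i = {x \<in> H. x \<in> elts (c p) \<and> (h q, x) \<in> E i}"
      for h :: "(nat \<Rightarrow> nat) \<Rightarrow> 'v" and p q i
    define Z where "Z = (\<Union>h\<in>T. \<Union>p\<in>D. \<Union>q\<in>D. \<Union>i\<in>{..<n} - {j}. W h p q i)"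
    have W: "finite (W h p q i) \<and> W h p q i \<subseteq> M j"
      if "h \<in> T" "p \<in> D" "q \<in> D" "i \<in> {..<n} - {j}" for h p q i
    proof
      have "W h p q i \<subseteq> E j `` {f p} \<inter> E i `` {h q}" using that by (auto simp: W_def c)
      then show fin: "finite (W h p q i)"
        using grid_finite_Int[OF grid jn] that finite_subset by blast
      have hq: "h q \<in> M j" using T that by (auto simp: X_def)
      have "dfn (\<lambda>s. (s(1 := h q)) 0 \<in> elts (c p) \<and> ((s(1 := h q)) 1, (s(1 := h q)) 0) \<in> E i)"
        by (rule dfn_subst[OF dfn_conj[OF dfn_mem_const[OF c(1)] dfn_rel[OF a(1) sub vrel]] hq])
          (use that in auto)
      then have "dfn (\<lambda>s. s 0 \<in> elts (c p) \<and> (h q, s 0) \<in> E i)" by simp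
      from finite_definable_subset[OF this]
      show "W h p q i \<subseteq> M j" using fin by (simp add: W_def)
    qed
    have finZ: "finite Z"
      unfolding Z_def using T finD W by (intro finite_UN_I) auto
    have ZM: "Z \<subseteq> M j" unfolding Z_def using W by (intro UN_least) blast
    have dfnZ: "dfn (\<lambda>s. good (\<lambda>p. s (v p)) \<and> (\<forall>p\<in>D. \<forall>z\<in>Z. \<not> s (v p) = z))"
      using ZM by (intro dfn_conj dfn_good dfn_ball finD finZ dfn_not dfn_eq_const) auto
    \<comment> \<open>The original \<open>f\<close>, with \<open>a\<close> as default value,
      witnesses the statement to be reflected: its points lie outside \<open>M j\<close>, whereas
      \<open>Z\<close> lies inside.\<close>
    let ?s = "\<lambda>k. if k \<in> v ` D then f (inv_into D v k) else a"
    have s: "?s (v p) = f p" if "p \<in> D" for p using that v by simp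
    have "range ?s \<subseteq> H"
      using a AH f1(1)[OF _ I(2)] by (auto simp: inv_into_into)
    moreover have "good (\<lambda>p. ?s (v p)) \<and> (\<forall>p\<in>D. \<forall>z\<in>Z. \<not> ?s (v p) = z)"
    proof
      have "f p \<in> elts (c p)" if "p \<in> D" for p
        using that c(2) f1(1)[OF that I(2)] eq[OF jn] by (auto simp: equiv_def refl_on_def)
      then have "good f" using f1 f2 m by (auto simp: good_def)
      then show "good (\<lambda>p. ?s (v p))" unfolding good_def using s by simp
      show "\<forall>p\<in>D. \<forall>z\<in>Z. \<not> ?s (v p) = z" using s f1(2)[OF _ I(2)] ZM by auto
    qed
    ultimately obtain t where t: "range t \<subseteq> M j"
        "good (\<lambda>p. t (v p)) \<and> (\<forall>p\<in>D. \<forall>z\<in>Z. \<not> t (v p) = z)"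
      by (rule reflect[OF dfnZ])
    have "R h (\<lambda>p. t (v p))" if "h \<in> T" for h
      unfolding R_def
    proof (intro ballI notI)
      fix p q i
      assume *: "p \<in> D" "q \<in> D" "i \<in> {..<n} - {j}" "(h q, t (v p)) \<in> E i"
      have "t (v p) \<in> elts (c p)" using t * by (auto simp: good_def)
      moreover have "t (v p) \<in> H" using t M_subset by auto
      ultimately have "t (v p) \<in> W h p q i" using *(4) by (simp only: W_def mem_Collect_eq simp_thms)
      then have "t (v p) \<in> Z" unfolding Z_def by (intro UN_I[OF that] UN_I[OF *(1)] UN_I[OF *(2)] UN_I[OF *(3)])
      from bspec[OF bspec[OF conjunct2[OF t(2)] *(1)] this] show False by simp
    qed
    moreover have "(\<lambda>p. t (v p)) \<in> X" using t by (auto simp: X_def)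
    ultimately show ?thesis by blast
  qed
  then have "\<exists>G :: nat \<Rightarrow> _. \<forall>r<l. G r \<in> X \<and> (\<forall>q<r. R (G q) (G r))"
    by (rule choose_sequence[where X = X and R = R])
  then obtain G where G: "\<And>r. r < l \<Longrightarrow> G r \<in> X" "\<And>r q. r < l \<Longrightarrow> q < r \<Longrightarrow> R (G q) (G r)"
    by blast
  \<comment> \<open>The new coordinate \<open>j\<close> selects the copy, the old coordinates a
    point in it.\<close>
  define g where "g p = G (p j) (restrict p ({..<n} - I))" for p
  have split: "{..<n} - (I - {j}) = insert j ({..<n} - I)" using jn by auto
  have coord: "p j < l" "restrict p ({..<n} - I) \<in> D"
    if "p \<in> PiE ({..<n} - (I - {j})) (\<lambda>_. {..<l})" for p
    using that unfolding split D_def by (auto simp: PiE_iff)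
  have good: "good (G r)" if "r < l" for r using G(1)[OF that] by (simp add: X_def)
  have goodE: "(f p, G r p) \<in> E j" "\<And>i. i \<in> I - {j} \<Longrightarrow> G r p \<notin> M i \<and> mem_as_set (E i `` {G r p}) (M i)"
    if "r < l" "p \<in> D" for r p
    using good[OF that(1)] that c(2) m(2) by (auto simp: good_def)
  have distinct: "(G r p, G r' q) \<notin> E i"
    if "r < l" "r' < l" "r \<noteq> r'" "p \<in> D" "q \<in> D" "i < n" "i \<noteq> j" for r r' p q i
  proof
    assume rel: "(G r p, G r' q) \<in> E i"
    \<comment> \<open>\<open>R\<close> only compares a copy with later ones; symmetry covers the
      other order.\<close>
    then have "(G r' q, G r p) \<in> E i" using eq[OF \<open>i < n\<close>] by (auto simp: equiv_def sym_def)
    then show False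
      using rel that G(2)[of r' r] G(2)[of r r'] by (cases "r < r'") (auto simp: R_def)
  qed
  have "partial_cube n A E l M (I - {j}) g"
    unfolding partial_cube_def
  proof (intro conjI ballI)
    fix p assume "p \<in> PiE ({..<n} - (I - {j})) (\<lambda>_. {..<l})"
    note p = coord[OF this]
    show "g p \<in> A" using goodE(1)[OF p] eq[OF jn] by (auto simp: g_def equiv_def)
    fix i assume "i \<in> I - {j}"
    then show "g p \<notin> M i" "mem_as_set (E i `` {g p}) (M i)"
      using goodE(2)[OF p] by (auto simp: g_def)
  next
    fix p q i
    assume "p \<in> PiE ({..<n} - (I - {j})) (\<lambda>_. {..<l})" "q \<in> PiE ({..<n} - (I - {j})) (\<lambda>_. {..<l})"
      and "i \<in> {..<n}"
    note p = coord[OF this(1)] and q = coord[OF this(2)] and i = this(3)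
    let ?p = "restrict p ({..<n} - I)" and ?q = "restrict q ({..<n} - I)"
    show "(g p, g q) \<in> E i \<longleftrightarrow> (\<forall>k\<in>{..<n} - (I - {j}) - {i}. p k = q k)"
    proof (cases "i = j")
      case True
      \<comment> \<open>All copies stay in the \<open>E j\<close>-classes of \<open>f\<close>, so
        \<open>E j\<close> ignores which copy is selected.\<close>
      have "(g p, g q) \<in> E j \<longleftrightarrow> (f ?p, f ?q) \<in> E j"
        using goodE(1)[OF p] goodE(1)[OF q] eq[OF jn]
        unfolding g_def equiv_def sym_def trans_def by meson
      also have "\<dots> \<longleftrightarrow> (\<forall>k\<in>{..<n} - I - {j}. p k = q k)"
        using f2[OF p(2) q(2) jn] by auto
      finally show ?thesis using True I by auto
    next
      case False
      \<comment> \<open>Inside one copy the claim is part of \<open>good\<close>. Across two copies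
        both sides fail: the left by \<open>distinct\<close>, the right at the coordinate
        \<open>j\<close>.\<close>
      show ?thesis
      proof (cases "p j = q j")
        case True
        then have "(g p, g q) \<in> E i \<longleftrightarrow> (\<forall>k\<in>{..<n} - I - {i}. ?p k = ?q k)"
          using good[OF p(1)] p q i unfolding g_def good_def by metis
        then show ?thesis unfolding split using True by auto
      next
        case neq: False
        then show ?thesis
          using distinct[OF p(1) q(1) neq p(2) q(2)] i False jn by (auto simp: g_def)
      qed
    qed
  qed
  then show ?thesis by (intro exI[where x = g])
qed

text \<open>Directions are added in decreasing order of their models: the greatest remaining model
  contains all the others, and the rest is still linearly ordered.\<close>

lemma partial_cube_complete:
  fixes a :: 'v
  assumes a: "a \<in> H" "A = elts a" and grid: "grid n A E"
    and "finite I" "I \<subseteq> {..<n}"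
    and M: "\<And>i. i \<in> I \<Longrightarrow> elementary_submodel (M i) H \<and> vstruct n A E \<in> M i"
    and trans: "transp_on I (\<lambda>i j. mem_as_set (M i) (M j))"
    and total: "totalp_on I (\<lambda>i j. mem_as_set (M i) (M j))"
    and "partial_cube n A E l M I f"
  shows "\<exists>g. partial_cube n A E l M {} g"
  using assms(4-)
proof (induction I arbitrary: f rule: finite_psubset_induct)
  case (psubset I)
  show ?case
  proof (cases "I = {}")
    case True
    then show ?thesis using psubset.prems by blast
  next
    case False
    then obtain j where j: "j \<in> I" "\<forall>i\<in>I. i \<noteq> j \<longrightarrow> mem_as_set (M i) (M j)"
      using Finite_Set.bex_greatest_element[OF psubset.hyps False] psubset.prems(3,4) by blast
    have "\<exists>g. partial_cube n A E l M (I - {j}) g"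
      by (rule partial_cube_extend[OF a grid psubset.prems(1) j(1) _ _ _ psubset.prems(5)])
        (use psubset.prems(2) j in auto)
    then obtain g where g: "partial_cube n A E l M (I - {j}) g" by (rule exE)
    show ?thesis
    proof (rule psubset.IH[OF _ _ _ _ _ g])
      show "transp_on (I - {j}) (\<lambda>i j. mem_as_set (M i) (M j))"
        using psubset.prems(3) by (rule transp_on_subset) auto
      show "totalp_on (I - {j}) (\<lambda>i j. mem_as_set (M i) (M j))"
        using psubset.prems(4) by (rule totalp_on_subset) auto
    qed (use j psubset.prems in auto)
  qed
qed

end

text \<open>For \<open>i \<noteq> k\<close> every \<open>E i\<close>-class meets \<open>C\<close> in
  a finite set, so points of \<open>X\<close> can be chosen one by one without new
  \<open>E i\<close>-relations. They form a line in direction \<open>k\<close>.\<close>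

lemma infinite_class_partial_cube:
  assumes grid: "grid n A E" and k: "k < n" and C: "C \<in> A // E k" and X: "infinite X" "X \<subseteq> C"
    and M: "\<And>x i. x \<in> X \<Longrightarrow> i < n \<Longrightarrow> i \<noteq> k \<Longrightarrow> x \<notin> M i \<and> mem_as_set (E i `` {x}) (M i)"
  shows "\<exists>f. partial_cube n A E l M ({..<n} - {k}) f"
proof -
  have eq: "equiv A (E i)" if "i < n" for i using grid that by (auto simp: grid_def)
  obtain y where y: "C = E k `` {y}" using C by (rule quotientE)
  define R where "R x z \<longleftrightarrow> (\<forall>i\<in>{..<n} - {k}. (x, z) \<notin> E i)" for x z
  have "\<exists>g\<in>X. \<forall>h\<in>T. R h g" if T: "finite T" "T \<subseteq> X" for T
  proof -
    have "finite (\<Union>h\<in>T. \<Union>i\<in>{..<n} - {k}. E k `` {y} \<inter> E i `` {h})"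
      using T grid_finite_Int[OF grid k] by (intro finite_UN_I) auto
    then obtain g where g: "g \<in> X" "g \<notin> (\<Union>h\<in>T. \<Union>i\<in>{..<n} - {k}. E k `` {y} \<inter> E i `` {h})"
      using X by (meson finite_subset subsetI)
    then show ?thesis using X y by (intro bexI[of _ g]) (auto simp: R_def)
  qed
  then have "\<exists>G :: nat \<Rightarrow> _. \<forall>r<l. G r \<in> X \<and> (\<forall>q<r. R (G q) (G r))"
    by (rule choose_sequence[where X = X and R = R])
  then obtain G where G: "\<And>r. r < l \<Longrightarrow> G r \<in> X" "\<And>r q. r < l \<Longrightarrow> q < r \<Longrightarrow> R (G q) (G r)"
    by blast
  have CA: "C \<subseteq> A" using C eq[OF k] by (auto simp: quotient_def equiv_def)
  have set: "{..<n} - ({..<n} - {k}) = {k}" using k by auto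
  have rel: "(G r, G q) \<in> E i \<longleftrightarrow> i = k \<or> r = q" if "r < l" "q < l" "i < n" for r q i
  proof -
    have "(G r, G q) \<in> E k"
      using G(1)[OF that(1)] G(1)[OF that(2)] X y eq[OF k]
      by (metis equiv_def Image_singleton_iff subsetD symD transD)
    moreover have "(G r, G q) \<notin> E i" if "i \<noteq> k" "r \<noteq> q"
    proof
      assume "(G r, G q) \<in> E i"
      moreover have "(G q, G r) \<in> E i"
        using calculation eq[OF \<open>i < n\<close>] by (auto simp: equiv_def sym_def)
      ultimately show False
        using G(2)[of r q] G(2)[of q r] \<open>r < l\<close> \<open>q < l\<close> \<open>i < n\<close> that
        by (cases "r < q") (auto simp: R_def)
    qed
    moreover have "(G q, G q) \<in> E i"
      using eq[OF \<open>i < n\<close>] G(1)[OF that(2)] X CA by (auto simp: equiv_def refl_on_def)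
    ultimately show ?thesis by blast
  qed
  have "partial_cube n A E l M ({..<n} - {k}) (\<lambda>p. G (p k))"
    unfolding partial_cube_def set
  proof (intro conjI ballI)
    fix p assume "p \<in> PiE {k} (\<lambda>_. {..<l})"
    then have GX: "G (p k) \<in> X" by (auto intro: G(1))
    then show "G (p k) \<in> A" using X CA by auto
    fix i assume "i \<in> {..<n} - {k}"
    then show "G (p k) \<notin> M i" "mem_as_set (E i `` {G (p k)}) (M i)" using M[OF GX] by auto
  next
    fix p q :: "nat \<Rightarrow> nat" and i
    assume "p \<in> PiE {k} (\<lambda>_. {..<l})" "q \<in> PiE {k} (\<lambda>_. {..<l})" "i \<in> {..<n}"
    then show "(G (p k), G (q k)) \<in> E i \<longleftrightarrow> (\<forall>j\<in>{k} - {i}. p j = q j)"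
      by (subst rel) auto
  qed
  then show ?thesis by (intro exI[where x = "\<lambda>p. G (p k)"])
qed

theorem theorem3p1:
  fixes \<theta> :: "'c rel"
    and n :: nat
    and A :: "'v::set_universe set"
    and E :: "nat \<Rightarrow> 'v rel"
  assumes "regular_uncountable \<theta>"
    and "contains_all_hereditary TYPE('v) \<theta>"
    and "mem_as_set A (hereditary \<theta>)"
    and "n \<ge> 2"
    and "grid n A E"
    and "\<not> twisted \<theta> n A E"
  shows "\<forall>l::nat. \<exists>f. grid_embedding n
           (cube_carrier n (\<lambda>_. {..<l})) (cube_rel n (\<lambda>_. {..<l})) A E f"
proof
  fix l
  interpret hereditary_universe \<theta> "TYPE('v)" by unfold_locales (rule assms)+
  obtain a where a: "a \<in> H" "A = elts a" using assms(3) by (auto simp: mem_as_set_def)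
  obtain \<M> k C where test: "test_set \<theta> n A E \<M>" and k: "k < n" and C: "C \<in> A // E k"
    and inf: "infinite (C \<inter> {x \<in> A - \<Union>\<M>. \<forall>i<n. i \<noteq> k \<longrightarrow> mem_as_set (E i `` {x}) (\<Union>\<M>)})"
    (is "infinite ?X")
    using assms(6) by (auto simp: twisted_def small_def)
  have elem: "elementary_submodel M H" "vstruct n A E \<in> M" if "M \<in> \<M>" for M
    using test that by (auto simp: test_set_def)
  have fin: "finite \<M>" using test by (simp add: test_set_def)
  let ?I = "{..<n} - {k}"
  let ?R = "\<lambda>x \<sigma>. \<forall>i\<in>?I. mem_as_set (E i `` {x}) (\<sigma> i)"
  have "\<exists>\<sigma>\<in>PiE ?I (\<lambda>_. \<M>). ?R x \<sigma>" if "x \<in> ?X" for x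
  proof -
    have "\<forall>i\<in>?I. \<exists>M\<in>\<M>. mem_as_set (E i `` {x}) M"
      using that by (fastforce simp: mem_as_set_def)
    then obtain \<sigma> where "\<forall>i\<in>?I. \<sigma> i \<in> \<M> \<and> mem_as_set (E i `` {x}) (\<sigma> i)" by metis
    then show ?thesis by (intro bexI[of _ "restrict \<sigma> ?I"]) auto
  qed
  \<comment> \<open>Only finitely many functions assign models to directions, so by the pigeonhole
    principle one of them serves infinitely many \<open>x\<close>.\<close>
  then have "\<exists>\<sigma>\<in>PiE ?I (\<lambda>_. \<M>). infinite {x \<in> ?X. ?R x \<sigma>}"
    using inf fin by (intro pigeonhole_infinite_rel) (auto intro: finite_PiE)
  then obtain \<sigma> where \<sigma>: "\<And>i. i \<in> ?I \<Longrightarrow> \<sigma> i \<in> \<M>" and inf': "infinite {x \<in> ?X. ?R x \<sigma>}"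
    by blast
  have inj: "i = j" if ij: "i \<in> ?I" "j \<in> ?I" "\<sigma> i = \<sigma> j" for i j
  proof (rule ccontr)
    assume "i \<noteq> j"
    obtain x where x: "x \<in> ?X" "?R x \<sigma>" using not_finite_existsD[OF inf'] by blast
    interpret elementary_hereditary \<theta> "TYPE('v)" "\<sigma> i"
      by unfold_locales (rule elem(1)[OF \<sigma>[OF ij(1)]])
    obtain c d where c: "c \<in> \<sigma> i" "elts c = E i `` {x}" and d: "d \<in> \<sigma> i" "elts d = E j `` {x}"
    proof -
      have "mem_as_set (E i `` {x}) (\<sigma> i)" "mem_as_set (E j `` {x}) (\<sigma> i)"
        using bspec[OF x(2) ij(1)] bspec[OF x(2) ij(2)] unfolding ij(3) .
      then show thesis using that unfolding mem_as_set_def by blast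
    qed
    \<comment> \<open>With both classes in one model, their finite intersection is contained in that
      model, and so is \<open>x\<close>, which was chosen outside all models.\<close>
    have "finite {x \<in> H. x \<in> elts c \<and> x \<in> elts d}"
      by (rule finite_subset[OF _ grid_finite_Int[OF assms(5), of i j x x]])
        (use c d ij \<open>i \<noteq> j\<close> in auto)
    then have "{x \<in> H. x \<in> elts c \<and> x \<in> elts d} \<subseteq> \<sigma> i"
      by (intro finite_definable_subset[OF dfn_conj[OF dfn_mem_const[OF c(1), of 0] dfn_mem_const[OF d(1), of 0]]]) auto
    moreover have "x \<in> elts c" "x \<in> elts d" "x \<in> H"
      using x ij assms(5) c d a hereditary_transitive[OF a(1)]
      by (auto simp: grid_def equiv_def refl_on_def)
    ultimately show False using x \<sigma>[OF ij(1)] by blast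
  qed
  have order: "transp_on ?I (\<lambda>i j. mem_as_set (\<sigma> i) (\<sigma> j))"
      "totalp_on ?I (\<lambda>i j. mem_as_set (\<sigma> i) (\<sigma> j))"
  proof -
    let ?S = "{(M, N). M \<in> \<M> \<and> N \<in> \<M> \<and> mem_as_set M N}"
    have S: "trans ?S" "total_on \<M> ?S"
      using test by (auto simp: test_set_def strict_linear_order_on_def)
    show "transp_on ?I (\<lambda>i j. mem_as_set (\<sigma> i) (\<sigma> j))"
      using transD[OF S(1)] \<sigma> by (intro transp_onI) blast
    show "totalp_on ?I (\<lambda>i j. mem_as_set (\<sigma> i) (\<sigma> j))"
    proof (rule totalp_onI)
      fix i j assume ij: "i \<in> ?I" "j \<in> ?I" "i \<noteq> j"
      \<comment> \<open>Injectivity of \<open>\<sigma>\<close> transfers totality from the models to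
        the directions.\<close>
      then have "\<sigma> i \<noteq> \<sigma> j" using inj[OF ij(1,2)] by blast
      then have "(\<sigma> i, \<sigma> j) \<in> ?S \<or> (\<sigma> j, \<sigma> i) \<in> ?S"
        by (rule S(2)[unfolded total_on_def, rule_format, OF \<sigma>[OF ij(1)] \<sigma>[OF ij(2)]])
      then show "mem_as_set (\<sigma> i) (\<sigma> j) \<or> mem_as_set (\<sigma> j) (\<sigma> i)" by blast
    qed
  qed
  have "\<exists>f. partial_cube n A E l \<sigma> ?I f"
    by (rule infinite_class_partial_cube[OF assms(5) k C inf']) (use \<sigma> in auto)
  then obtain f where f: "partial_cube n A E l \<sigma> ?I f" by (rule exE)
  have "\<exists>g. partial_cube n A E l \<sigma> {} g"
    by (rule partial_cube_complete[OF a assms(5) _ _ _ order f]) (use elem \<sigma> in auto)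
  then show "\<exists>f. grid_embedding n
      (cube_carrier n (\<lambda>_. {..<l})) (cube_rel n (\<lambda>_. {..<l})) A E f"
    using partial_cube_grid_embedding assms(4,5) by blast
qed

end
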